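(* It is not possible to cut a balanced polygon in the plane into an odd number of triangles, all having equal areas, in such a way that all rectangular coordinates of all vertices of the triangles are rational numbers.
   Context: A plane polygon with clockwise oriented boundary is called balanced if its edges can be divided into pairs so that in each pair the two edges are parallel, equal in length, and have opposite orientation (the orientation of an edge comes from the orientation of the boundary). A polygon is cut into triangles if it is divided into triangles by straight segments; degenerate situations in which a vertex of one triangle lies in the interior of an edge of another triangle or of the polygon are allowed. *)

theory Defs
  imports "HOL-Complex_Analysis.Complex_Analysis"
begin

text \<open>
  The plane is modelled by \<^typ>\<open>complex\<close>, the rectangular coordinates of a point being its real and
  imaginary part, so that orientation can be expressed by the library's winding number.
\<close>

fun polyline :: "complex list \<Rightarrow> real \<Rightarrow> complex" where
  "polyline [] = linepath 0 0"
| "polyline [a] = linepath a a"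
| "polyline [a, b] = linepath a b"
| "polyline (a # b # c # vs) = linepath a b +++ polyline (b # c # vs)"

text \<open>
  A polygon is given by the cyclic list of its vertices. The final edge leads from the last vertex
  back to the first.
\<close>

definition boundary_path :: "complex list \<Rightarrow> real \<Rightarrow> complex" where
  "boundary_path vs = polyline (vs @ [hd vs])"

definition edge :: "complex list \<Rightarrow> nat \<Rightarrow> complex" where
  "edge vs i = vs ! (Suc i mod length vs) - vs ! i"

definition polygon_region :: "complex list \<Rightarrow> complex set" where
  "polygon_region vs =
     path_image (boundary_path vs) \<union> inside (path_image (boundary_path vs))"

text \<open>
  Simplicity of the boundary excludes edges of length zero. Consecutive edges may point in the same
  direction, i.e. an interior angle may be straight; thus polyominoes with boundary divided into
  unit edges are covered.
\<close>

definition clockwise_polygon :: "complex list \<Rightarrow> bool" where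
  "clockwise_polygon vs \<longleftrightarrow>
     length vs \<ge> 3 \<and> simple_path (boundary_path vs) \<and>
     (\<forall>z \<in> inside (path_image (boundary_path vs)). winding_number (boundary_path vs) z = -1)"

text \<open>For non-zero \<open>d\<close> and \<open>e\<close>: parallel, of opposite orientation, and of equal length.\<close>

definition opposite_edges :: "complex \<Rightarrow> complex \<Rightarrow> bool" where
  "opposite_edges d e \<longleftrightarrow> (\<exists>c::real. c < 0 \<and> e = c *\<^sub>R d) \<and> norm d = norm e"

definition balanced_polygon :: "complex list \<Rightarrow> bool" where
  "balanced_polygon vs \<longleftrightarrow>
     clockwise_polygon vs \<and>
     (\<exists>P. partition_on {..<length vs} P \<and>
          (\<forall>A\<in>P. \<exists>i j. i \<noteq> j \<and> A = {i, j} \<and> opposite_edges (edge vs i) (edge vs j)))"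

text \<open>
  A cutting need not be face-to-face: a vertex of one triangle may lie in the interior of an edge of
  another triangle or of the polygon. Each triangle is a nondegenerate closed triangle.
\<close>

definition cut_into_triangles :: "complex set \<Rightarrow> complex set set \<Rightarrow> bool" where
  "cut_into_triangles S \<T> \<longleftrightarrow>
     finite \<T> \<and> (\<forall>T\<in>\<T>. 2 simplex T) \<and> \<Union>\<T> = S \<and>
     (\<forall>T\<in>\<T>. \<forall>U\<in>\<T>. T \<noteq> U \<longrightarrow> interior T \<inter> interior U = {})"

definition vertices :: "complex set \<Rightarrow> complex set" where
  "vertices T = {v. v extreme_point_of T}"

end

theory Submission
  imports Defs
begin

text \<open>
  Let \<open>f\<close> be a real-valued function on vectors that is homogeneous along every line through \<open>0\<close>, and
  sum it over the clockwise boundary edges of every triangle. Crossing a directed segment changes its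
  winding number by one, so the edges lying on a fixed line cancel, with lengths counted with sign,
  as soon as the total winding number vanishes almost everywhere. Hence the sum over the triangles
  equals the sum over the boundary of the polygon, which is \<open>0\<close> for a balanced polygon.

  If the triangles are rational of equal area, \<open>f\<close> can be chosen such that each of them contributes
  \<open>C\<close> times an odd integer, so their number must be even. After a linear change of coordinates all
  edges have the form \<open>x (1, t)\<close> with integers \<open>x\<close> and \<open>t\<close>, and the common determinant is a square.
  Then \<open>f (x, x t) = x h(t)\<close> works, where \<open>h\<close> maps \<open>\<Sum> b\<^sub>i 2\<^sup>i\<close> to \<open>\<Sum> b\<^sub>2\<^sub>i 2\<^sup>i\<close> (truncated at a sufficiently high
  binary digit): the 2-adic valuation of \<open>h(t) - h(s)\<close> is half that of \<open>t - s\<close> if the latter is even,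
  and more than half of it otherwise.
\<close>

section \<open>A 2-adic functional on rational vectors\<close>

text \<open>Digits are meant 2-adically: a negative \<open>t\<close> has infinitely many nonzero
  ones, so the first argument bounds how many digits at even positions are kept.\<close>

primrec halve_digits :: "nat \<Rightarrow> int \<Rightarrow> int" where
  "halve_digits 0 t = 0"
| "halve_digits (Suc n) t = t mod 2 + 2 * halve_digits n (t div 4)"

text \<open>The hypothesis says that \<open>t\<close> and \<open>s\<close> share their lowest
  \<open>l\<close> binary digits. Of the positions below \<open>l\<close>,
  \<open>(l + 1) div 2\<close> are even, and their digits become the lowest ones of the results.
  Each induction step strips two digits.\<close>

lemma halve_digits_dvd:
  assumes "2 ^ l dvd t - s" "l \<le> 2 * n"
  shows "2 ^ ((l + 1) div 2) dvd halve_digits n t - halve_digits n s"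
  using assms
proof (induction n arbitrary: l t s)
  case 0
  then show ?case by simp
next
  case (Suc n)
  consider "l = 0" | "l = 1" | k where "l = k + 2"
    by (metis add_2_eq_Suc' not0_implies_Suc One_nat_def)
  then show ?case
  proof cases
    case 1
    then show ?thesis by simp
  next
    case 2
    then have "t mod 2 = s mod 2"
      using Suc.prems by (simp add: mod_eq_dvd_iff)
    then show ?thesis using 2 by simp
  next
    case 3
    have d: "2 ^ k * 4 dvd t - s" using Suc.prems 3 by (simp add: mult.commute)
    then have "4 dvd t - s" by (meson dvd_mult_right)
    then have 4: "t mod 4 = s mod 4" by (simp add: mod_eq_dvd_iff)
    then have 2: "t mod 2 = s mod 2" by (metis mod_mod_cancel even_numeral)
    have e: "t - s = (t div 4 - s div 4) * 4"
      using 4 by (simp add: left_diff_distrib flip: minus_mod_eq_div_mult)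
    have "2 ^ k dvd t div 4 - s div 4" using d unfolding e by (subst (asm) dvd_mult_cancel_right) simp
    then have "2 ^ ((k + 1) div 2) dvd halve_digits n (t div 4) - halve_digits n (s div 4)"
      using Suc.IH Suc.prems 3 by simp
    then have "2 * 2 ^ ((k + 1) div 2) dvd 2 * (halve_digits n (t div 4) - halve_digits n (s div 4))"
      by (rule mult_dvd_mono[OF dvd_refl])
    moreover have "(l + 1) div 2 = Suc ((k + 1) div 2)" using 3 by simp
    ultimately show ?thesis using 2 by (simp add: right_diff_distrib)
  qed
qed

text \<open>The lowest digit in which \<open>t\<close> and \<open>s\<close> differ has the even
  position \<open>2 * i\<close>, so it survives as digit \<open>i\<close>; by \<open>i < n\<close>
  it lies below the truncation.\<close>

lemma halve_digits_not_dvd: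
  assumes "2 ^ (2 * i) dvd t - s" "\<not> 2 ^ (2 * i + 1) dvd t - s" "i < n"
  shows "\<not> 2 ^ (i + 1) dvd halve_digits n t - halve_digits n s"
  using assms
proof (induction n arbitrary: i t s)
  case 0
  then show ?case by simp
next
  case (Suc n)
  show ?case
  proof (cases i)
    case 0
    then have "odd (t - s)" using Suc.prems by simp
    then show ?thesis using 0 by simp
  next
    case (Suc k)
    have d: "2 ^ (2 * k) * 4 dvd t - s" and nd: "\<not> 2 ^ (2 * k + 1) * 4 dvd t - s"
      using Suc.prems Suc by (simp_all add: mult_ac)
    then have "4 dvd t - s" by (meson dvd_mult_right)
    then have 4: "t mod 4 = s mod 4" by (simp add: mod_eq_dvd_iff)
    then have 2: "t mod 2 = s mod 2" by (metis mod_mod_cancel even_numeral)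
    have e: "t - s = (t div 4 - s div 4) * 4"
      using 4 by (simp add: left_diff_distrib flip: minus_mod_eq_div_mult)
    have "2 ^ (2 * k) dvd t div 4 - s div 4" "\<not> 2 ^ (2 * k + 1) dvd t div 4 - s div 4"
      using d nd unfolding e dvd_mult_cancel_right by simp_all
    then have "\<not> 2 ^ (k + 1) dvd halve_digits n (t div 4) - halve_digits n (s div 4)"
      using Suc.IH Suc.prems Suc by simp
    then have "\<not> 2 * 2 ^ (k + 1) dvd 2 * (halve_digits n (t div 4) - halve_digits n (s div 4))"
      unfolding dvd_mult_cancel_left by linarith
    moreover have "halve_digits (Suc n) t - halve_digits (Suc n) s =
        2 * (halve_digits n (t div 4) - halve_digits n (s div 4))"
      using 2 by simp
    ultimately show ?thesis unfolding Suc by (metis Suc_eq_plus1 power_Suc)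
  qed
qed

lemma power_2_dvd_mult_odd_iff:
  fixes a b :: int
  assumes "odd a"
  shows "2 ^ n dvd a * b \<longleftrightarrow> 2 ^ n dvd b"
  using assms by (simp add: coprime_dvd_mult_right_iff)

lemma power_2_dvd_power_2_mult_odd_iff:
  fixes a :: int
  assumes "odd a"
  shows "2 ^ n dvd 2 ^ k * a \<longleftrightarrow> n \<le> k"
proof -
  have "2 ^ n dvd 2 ^ k * a \<longleftrightarrow> (2::int) ^ n dvd 2 ^ k"
    using power_2_dvd_mult_odd_iff[OF assms, of n "2 ^ k"] by (simp add: mult.commute)
  then show ?thesis by (simp add: dvd_power_iff)
qed

lemma int_power_2_mult_odd:
  fixes z :: int
  assumes "z \<noteq> 0"
  obtains r w where "z = 2 ^ r * w" "odd w"
  using multiplicity_decompose'[of z 2] assms that by (metis odd_one)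

text \<open>The vectors \<open>x_i (1, t_i)\<close> are the sides of a triangle, and
  \<open>x1 * x2 * (t2 - t1)\<close> is the determinant of the first two. As twice the signed area
  it is invariant under cyclic rotation.\<close>

lemma rotate_determinant:
  fixes x1 x2 x3 t1 t2 t3 :: int
  assumes "x1 + x2 + x3 = 0" "x1 * t1 + x2 * t2 + x3 * t3 = 0"
  shows "x2 * x3 * (t3 - t2) = x1 * x2 * (t2 - t1)"
proof -
  have t3: "x3 * t3 = - (x1 * t1 + x2 * t2)" and x3: "x3 = - (x1 + x2)" using assms by linarith+
  have "x2 * x3 * (t3 - t2) = x2 * (x3 * t3 - x3 * t2)" by (simp add: algebra_simps)
  also have "\<dots> = x1 * x2 * (t2 - t1)" unfolding t3 unfolding x3 by (simp add: algebra_simps)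
  finally show ?thesis .
qed

text \<open>The first coordinates of two edges have the same 2-adic valuation \<open>e\<close>; that
  of the third is larger. The determinant forces \<open>t2 - t1\<close> to have the even valuation
  \<open>2 * (m - e)\<close>, so its counterpart under \<open>halve_digits\<close> has valuation
  exactly \<open>m - e\<close>. The contribution of the third edge is strictly more divisible and
  cannot disturb this.\<close>

lemma halve_digits_sum_aux:
  fixes x1 x2 x3 t1 t2 t3 c :: int
  assumes sum: "x1 + x2 + x3 = 0" and lin: "x1 * t1 + x2 * t2 + x3 * t3 = 0"
    and D: "x1 * x2 * (t2 - t1) = 2 ^ (2 * m) * c" and c: "odd c" and "m < n"
    and y: "x1 = 2 ^ e * y1" "x2 = 2 ^ e * y2" "odd y1" "odd y2"
  shows "\<exists>k. odd k \<and> x1 * halve_digits n t1 + x2 * halve_digits n t2 + x3 * halve_digits n t3 = 2 ^ m * k"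
proof -
  define h where "h = halve_digits n"
  define z where "z = y1 + y2"
  have x3: "x3 = - (2 ^ e * z)" using sum y by (simp add: z_def algebra_simps)
  have sq: "(2::int) ^ (2 * e) = 2 ^ e * 2 ^ e" by (simp add: mult_2 power_add)
  have D1: "2 ^ (2 * e) * (y1 * y2 * (t2 - t1)) = 2 ^ (2 * m) * c"
    unfolding D[symmetric] sq y(1,2) by (simp only: mult_ac)
  have "2 ^ (2 * e) dvd 2 ^ (2 * m) * c" unfolding D1[symmetric] by simp
  then have em: "e \<le> m" using power_2_dvd_power_2_mult_odd_iff[OF c] by simp
  define i where "i = m - e"
  have m: "m = e + i" using em by (simp add: i_def)
  have D2: "y1 * y2 * (t2 - t1) = 2 ^ (2 * i) * c"
    using D1 unfolding m by (simp add: power_add distrib_left mult.assoc)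
  have "x2 * x3 * (t3 - t2) = x1 * x2 * (t2 - t1)"
    by (rule rotate_determinant[OF sum lin])
  then have "2 ^ (2 * e) * (y2 * z * (t2 - t3)) = 2 ^ (2 * m) * c"
    unfolding D[symmetric] sq y(2) x3 by (simp add: algebra_simps)
  then have D3: "y2 * z * (t2 - t3) = 2 ^ (2 * i) * c"
    unfolding m by (simp add: power_add distrib_left mult.assoc)
  have "z \<noteq> 0" using D3 c by auto
  have yy: "odd (y1 * y2)" using y by simp
  have 1: "2 ^ k dvd t2 - t1 \<longleftrightarrow> k \<le> 2 * i" for k
    using power_2_dvd_mult_odd_iff[OF yy, of k "t2 - t1"] power_2_dvd_power_2_mult_odd_iff[OF c, of k "2 * i"] D2
    by simp
  have h12: "2 ^ i dvd h t2 - h t1"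
    using halve_digits_dvd[of "2 * i" t2 t1 n] 1 \<open>m < n\<close> m by (simp add: h_def)
  have h12': "\<not> 2 ^ (i + 1) dvd h t2 - h t1"
    unfolding h_def by (rule halve_digits_not_dvd) (use 1[of "2 * i"] 1[of "2 * i + 1"] \<open>m < n\<close> m in auto)
  obtain r w where w: "z = 2 ^ r * w" "odd w"
    using \<open>z \<noteq> 0\<close> int_power_2_mult_odd by blast
  have "even z" using y by (simp add: z_def)
  then have "r \<noteq> 0" using w by (metis power_0 mult_1)
  have D4: "2 ^ r * (y2 * w * (t2 - t3)) = 2 ^ (2 * i) * c"
    using D3 w by (simp add: mult_ac)
  have "2 ^ r dvd 2 ^ (2 * i) * c" unfolding D4[symmetric] by simp
  then have r: "r \<le> 2 * i" using power_2_dvd_power_2_mult_odd_iff[OF c] by simp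
  have "2 ^ r * (y2 * w * (t2 - t3)) = 2 ^ r * (2 ^ (2 * i - r) * c)"
    using r unfolding D4 by (simp flip: power_add mult.assoc)
  then have D5: "y2 * w * (t2 - t3) = 2 ^ (2 * i - r) * c" by simp
  have "2 ^ (2 * i - r) dvd y2 * w * (t2 - t3)" unfolding D5 by simp
  then have "2 ^ (2 * i - r) dvd t2 - t3"
    using power_2_dvd_mult_odd_iff[of "y2 * w"] w y by simp
  then have "2 ^ ((2 * i - r + 1) div 2) dvd h t2 - h t3"
    unfolding h_def by (rule halve_digits_dvd) (use \<open>m < n\<close> m in auto)
  then have "2 ^ (r + (2 * i - r + 1) div 2) dvd z * (h t2 - h t3)"
    using w by (simp add: power_add mult_dvd_mono)
  \<comment> \<open>Rounding up gives the exponent at least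
    \<open>r + (2 * i - r) / 2 = i + r / 2\<close>, which exceeds \<open>i\<close> because
    \<open>z\<close> is even.\<close>
  moreover have "2 * i - r \<le> 2 * ((2 * i - r + 1) div 2)" by simp
  then have "i + 1 \<le> r + (2 * i - r + 1) div 2" using r \<open>r \<noteq> 0\<close> by linarith
  ultimately have z: "2 ^ (i + 1) dvd z * (h t2 - h t3)"
    using power_le_dvd by blast
  \<comment> \<open>Since \<open>z = y1 + y2\<close>, the whole sum is a combination of differences
    with \<open>h t2\<close>. The first summand of \<open>S\<close> has valuation exactly
    \<open>i\<close>, the second at least \<open>i + 1\<close>.\<close>
  define S where "S = y1 * (h t2 - h t1) - z * (h t2 - h t3)"
  have S: "x1 * h t1 + x2 * h t2 + x3 * h t3 = 2 ^ e * - S"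
    unfolding S_def y(1,2) x3 by (simp add: z_def algebra_simps)
  have "2 ^ i dvd S"
    unfolding S_def using h12 z by (meson dvd_diff dvd_mult power_le_dvd le_add1)
  then obtain k where k: "S = 2 ^ i * k" ..
  have "\<not> 2 ^ (i + 1) dvd S"
    unfolding S_def using h12' z power_2_dvd_mult_odd_iff[OF y(3)]
    by (metis dvd_diff_left_iff)
  then have "odd k" using k by (auto simp: mult.commute)
  moreover have "x1 * h t1 + x2 * h t2 + x3 * h t3 = 2 ^ m * - k"
    unfolding S k m by (simp add: power_add)
  ultimately show ?thesis unfolding h_def by (metis dvd_minus_iff)
qed

text \<open>After division by the gcd of \<open>x1\<close> and \<open>x2\<close>, the three first
  coordinates are pairwise coprime with sum zero, so exactly two are odd. A cyclic rotation, which
  preserves the determinant, moves these two to the front.\<close>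

lemma halve_digits_sum:
  fixes x1 x2 x3 t1 t2 t3 c :: int
  assumes sum: "x1 + x2 + x3 = 0" and lin: "x1 * t1 + x2 * t2 + x3 * t3 = 0"
    and D: "x1 * x2 * (t2 - t1) = 2 ^ (2 * m) * c" and c: "odd c" and "m < n"
  shows "\<exists>k. odd k \<and> x1 * halve_digits n t1 + x2 * halve_digits n t2 + x3 * halve_digits n t3 = 2 ^ m * k"
proof -
  define g where "g = gcd x1 x2"
  have "x1 \<noteq> 0" using D c by auto
  then have "g \<noteq> 0" by (simp add: g_def)
  then obtain e g' where g: "g = 2 ^ e * g'" "odd g'"
    using int_power_2_mult_odd by blast
  obtain a1 a2 where a: "x1 = g * a1" "x2 = g * a2" "coprime a1 a2"
    using gcd_coprime_exists[of x1 x2] \<open>g \<noteq> 0\<close> by (metis g_def mult.commute)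
  have a3: "x3 = 2 ^ e * (- g' * (a1 + a2))" using sum a g by (simp add: algebra_simps)
  have a12: "x1 = 2 ^ e * (g' * a1)" "x2 = 2 ^ e * (g' * a2)" using a g by simp_all
  have "odd a1 \<or> odd a2" using a(3) by (metis coprime_common_divisor odd_one dvd_refl zdvd1_eq numeral_eq_one_iff not_is_unit_0 abs_numeral semiring_norm(85))
  have s2: "x2 + x3 + x1 = 0" and l2: "x2 * t2 + x3 * t3 + x1 * t1 = 0" using sum lin by simp_all
  have s3: "x3 + x1 + x2 = 0" and l3: "x3 * t3 + x1 * t1 + x2 * t2 = 0" using sum lin by simp_all
  have D2: "x2 * x3 * (t3 - t2) = 2 ^ (2 * m) * c" using rotate_determinant[OF sum lin] D by simp
  have D3: "x3 * x1 * (t1 - t3) = 2 ^ (2 * m) * c" using rotate_determinant[OF s2 l2] D2 by simp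
  consider "odd a1" "odd a2" | "odd a2" "even a1" | "odd a1" "even a2"
    using \<open>odd a1 \<or> odd a2\<close> by blast
  then show ?thesis
  proof cases
    case 1
    then show ?thesis
      using halve_digits_sum_aux[OF sum lin D c \<open>m < n\<close> a12] g by simp
  next
    case 2
    then show ?thesis
      using halve_digits_sum_aux[OF s2 l2 D2 c \<open>m < n\<close> a12(2) a3] g 2
      by (simp add: add_ac)
  next
    case 3
    then show ?thesis
      using halve_digits_sum_aux[OF s3 l3 D3 c \<open>m < n\<close> a3 a12(1)] g 3
      by (simp add: add_ac)
  qed
qed

section \<open>Integral coordinates for finitely many rational vectors\<close>

lemma finite_rat_common_denominator:
  fixes S :: "real set"
  assumes "finite S" "S \<subseteq> \<rat>"
  obtains N :: nat where "N > 0" "\<And>x. x \<in> S \<Longrightarrow> of_nat N * x \<in> \<int>"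
proof -
  have "\<exists>N::nat. N > 0 \<and> (\<forall>x\<in>S. of_nat N * x \<in> \<int>)"
    using assms
  proof (induction S rule: finite_induct)
    case empty
    then show ?case by auto
  next
    case (insert y S)
    then obtain N :: nat where N: "N > 0" "\<forall>x\<in>S. of_nat N * x \<in> \<int>" by auto
    obtain p :: int and q :: nat where q: "q > 0" "y = of_int p / of_nat q"
      using insert.prems by (auto simp: Rats_eq_int_div_nat)
    have "of_nat (N * q) * x \<in> \<int>" if "x \<in> insert y S" for x :: real
    proof (cases "x = y")
      case True
      have "of_nat (N * q) * y = of_int (int N * p)" using q by simp
      then show ?thesis using True by (metis Ints_of_int)
    next
      case False
      have "of_nat (N * q) * x = of_nat q * (of_nat N * x)" by simp
      then show ?thesis using False that N by (metis Ints_mult Ints_of_nat insertE)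
    qed
    then show ?case using N q by (intro exI[of _ "N * q"]) auto
  qed
  then show ?thesis using that by blast
qed

definition cross :: "complex \<Rightarrow> complex \<Rightarrow> real" where
  "cross u v = Re u * Im v - Im u * Re v"

text \<open>Intended for \<open>V\<close> the set of edge vectors of all triangles and
  \<open>a\<close> twice their common area. A shear and a rescaling make the coordinates integral
  and the determinant a square up to sign, which is the situation of
  \<open>halve_digits_sum\<close>.\<close>

lemma odd_edge_functional:
  fixes V :: "complex set"
  assumes fin: "finite V" and rat: "\<And>v. v \<in> V \<Longrightarrow> Re v \<in> \<rat> \<and> Im v \<in> \<rat>" and nz: "0 \<notin> V"
    and a: "a \<in> \<rat>" "a > 0"
  obtains f :: "complex \<Rightarrow> real" and C :: real where
    "C \<noteq> 0" "\<And>s z. f (of_real s * z) = s * f z"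
    "\<And>u v w. \<lbrakk>u \<in> V; v \<in> V; w \<in> V; u + v + w = 0; \<bar>cross u v\<bar> = a\<rbrakk>
       \<Longrightarrow> \<exists>k::int. odd k \<and> f u + f v + f w = C * of_int k"
proof -
  have "finite ((\<lambda>v. - Re v / Im v) ` V)" using fin by simp
  then have "finite {s::nat. of_nat s \<in> (\<lambda>v. - Re v / Im v) ` V}"
    by (rule finite_vimageI[unfolded vimage_def]) (simp add: inj_on_def)
  then have fin': "finite (insert 0 {s::nat. of_nat s \<in> (\<lambda>v. - Re v / Im v) ` V})" by simp
  \<comment> \<open>A generic shear: \<open>s\<close> avoids the finitely many values for which
    \<open>Re v + s * Im v\<close> could vanish on \<open>V\<close>.\<close>
  obtain s :: nat where s: "s \<notin> insert 0 {s::nat. of_nat s \<in> (\<lambda>v. - Re v / Im v) ` V}"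
    using ex_new_if_finite[OF infinite_UNIV_nat fin'] by blast
  define X where "X v = Re v + of_nat s * Im v" for v
  have X0: "X v \<noteq> 0" if "v \<in> V" for v
  proof (cases "Im v = 0")
    case True
    have "v \<noteq> 0" using that nz by blast
    then have "Re v \<noteq> 0" using True by (simp add: complex_eq_iff)
    then show ?thesis using True by (simp add: X_def)
  next
    case False
    have "of_nat s \<noteq> - Re v / Im v" using s that by auto
    then show ?thesis using False by (auto simp: X_def field_simps)
  qed
  have XR: "X v \<in> \<rat>" if "v \<in> V" for v using rat[OF that] by (simp add: X_def)
  have tR: "Im v / X v \<in> \<rat>" if "v \<in> V" for v using rat[OF that] XR[OF that] by simp
  obtain N :: nat where N: "N > 0" "\<And>x. x \<in> X ` V \<Longrightarrow> of_nat N * x \<in> \<int>"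
    using finite_rat_common_denominator[of "X ` V"] fin XR by auto
  obtain R :: nat where R: "R > 0" "\<And>x. x \<in> (\<lambda>v. Im v / X v) ` V \<Longrightarrow> of_nat R * x \<in> \<int>"
    using finite_rat_common_denominator[of "(\<lambda>v. Im v / X v) ` V"] fin tR by auto
  obtain p' :: int and q :: nat where pq: "q > 0" "a = of_int p' / of_nat q"
    using a(1) by (auto simp: Rats_eq_int_div_nat)
  have "p' > 0" using a pq by (simp add: field_simps)
  define p where "p = nat p'"
  have p: "p > 0" "a = of_nat p / of_nat q" using \<open>p' > 0\<close> pq by (simp_all add: p_def)
  \<comment> \<open>One factor \<open>R\<close> clears the denominators of the slopes. The remaining
    factors turn \<open>N * N * Q * a\<close>, where \<open>a = p / q\<close>, into the square of
    \<open>N * R * p\<close>.\<close>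
  define Q where "Q = R ^ 2 * p * q"
  define M where "M = N * R * p"
  have "int M \<noteq> 0" using N R p by (simp add: M_def)
  then obtain m c where M: "int M = 2 ^ m * c" "odd c"
    using int_power_2_mult_odd by blast
  define h where "h = halve_digits (Suc m)"
  \<comment> \<open>On \<open>V\<close> the scaled slope is an integer, so the floor merely extends
    \<open>f\<close> to all vectors. The slope is unchanged by nonzero scaling, and where its
    denominator is zero the factor \<open>X z\<close> makes \<open>f\<close> vanish; hence
    \<open>f\<close> is homogeneous.\<close>
  define f where "f z = X z * of_int (h \<lfloor>of_nat Q * (Im z / X z)\<rfloor>)" for z
  have hom: "f (of_real r * z) = r * f z" for r z
  proof (cases "r = 0")
    case True
    then show ?thesis by (simp add: f_def X_def)
  next
    case False
    have "X (of_real r * z) = r * X z" by (simp add: X_def algebra_simps)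
    then show ?thesis using False by (simp add: f_def)
  qed
  have odd_sum: "\<exists>k::int. odd k \<and> f u + f v + f w = (2 ^ m / of_nat N) * of_int k"
    if V: "u \<in> V" "v \<in> V" "w \<in> V" and sum: "u + v + w = 0" and A: "\<bar>cross u v\<bar> = a" for u v w
  proof -
    have "\<exists>x t. of_nat N * X v = of_int x \<and> of_nat Q * (Im v / X v) = of_int t" if "v \<in> V" for v
    proof -
      have QR: "real Q = real (R * p * q) * real R"
        by (simp add: Q_def power2_eq_square)
      have "real R * (Im v / X v) \<in> \<int>" by (rule R(2)) (use that in blast)
      then have "real (R * p * q) * (real R * (Im v / X v)) \<in> \<int>"
        by (rule Ints_mult[OF Ints_of_nat])
      then have 1: "real Q * (Im v / X v) \<in> \<int>" unfolding QR by (simp only: mult.assoc)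
      have 2: "real N * X v \<in> \<int>" by (rule N(2)) (use that in blast)
      show ?thesis using Ints_cases[OF 1] Ints_cases[OF 2] by metis
    qed
    then obtain x t where xt: "\<And>v. v \<in> V \<Longrightarrow> of_nat N * X v = of_int (x v)"
        "\<And>v. v \<in> V \<Longrightarrow> of_nat Q * (Im v / X v) = of_int (t v)"
      by metis
    have f: "of_nat N * f v = of_int (x v * h (t v))" if "v \<in> V" for v
      using xt[OF that] by (simp add: f_def flip: mult.assoc)
    have xt': "of_int (x v * t v) = of_nat (N * Q) * Im v" if "v \<in> V" for v
    proof -
      have "of_int (x v * t v) = (of_nat N * X v) * (of_nat Q * (Im v / X v))"
        using xt[OF that] by simp
      then show ?thesis using X0[OF that] by simp
    qed
    have w: "w = - u - v" using sum by (simp add: algebra_simps eq_neg_iff_add_eq_0)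
    have "of_int (x u + x v + x w) = (0::real)"
      using V by (simp flip: xt add: w X_def algebra_simps)
    then have s1: "x u + x v + x w = 0" by linarith
    have "of_int (x u * t u + x v * t v + x w * t w) = (0::real)"
      unfolding of_int_add xt'[OF V(1)] xt'[OF V(2)] xt'[OF V(3)] by (simp add: w algebra_simps)
    then have s2: "x u * t u + x v * t v + x w * t w = 0" by linarith
    have "of_int (x u * x v * (t v - t u)) = of_int (x u) * of_int (x v * t v) - of_int (x v) * (of_int (x u * t u) :: real)"
      by (simp add: algebra_simps)
    also have "\<dots> = (of_nat N * X u) * (of_nat (N * Q) * Im v) - (of_nat N * X v) * (of_nat (N * Q) * Im u)"
      by (simp only: xt xt' V)
    \<comment> \<open>The shear has determinant 1, so the terms containing \<open>s\<close>
      cancel.\<close>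
    also have "\<dots> = of_nat (N * N * Q) * cross u v"
      by (simp add: X_def cross_def algebra_simps)
    finally have D: "of_int (x u * x v * (t v - t u)) = of_nat (N * N * Q) * cross u v" .
    have "of_nat (N * N * Q) * a = of_nat (M * M)"
      using pq(1) by (simp add: p(2) Q_def M_def power2_eq_square)
    then have "\<bar>of_int (x u * x v * (t v - t u))\<bar> = (of_nat (M * M) :: real)"
      unfolding D using A by (simp add: abs_mult)
    then have "\<bar>x u * x v * (t v - t u)\<bar> = int M * int M"
      by (metis of_int_abs of_int_eq_iff of_int_of_nat_eq of_nat_mult)
    also have "\<dots> = 2 ^ (2 * m) * (c * c)" unfolding M by (simp add: mult_2 power_add)
    \<comment> \<open>The orientation is not fixed, but with either sign the cofactor of
      \<open>2 ^ (2 * m)\<close> is odd.\<close>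
    finally have "x u * x v * (t v - t u) = 2 ^ (2 * m) * (c * c) \<or> x u * x v * (t v - t u) = 2 ^ (2 * m) * - (c * c)"
      by linarith
    then obtain d where d: "x u * x v * (t v - t u) = 2 ^ (2 * m) * d" "odd d"
      using M(2) by (metis even_minus even_mult_iff)
    obtain k where k: "odd k" "x u * h (t u) + x v * h (t v) + x w * h (t w) = 2 ^ m * k"
      using halve_digits_sum[OF s1 s2 d lessI] by (auto simp: h_def)
    have "of_nat N * (f u + f v + f w) = of_int (x u * h (t u) + x v * h (t v) + x w * h (t w))"
      unfolding distrib_left f[OF V(1)] f[OF V(2)] f[OF V(3)] by simp
    then have "of_nat N * (f u + f v + f w) = 2 ^ m * of_int k" unfolding k(2) by simp
    then show ?thesis using k(1) N(1) by (intro exI[of _ k]) (simp add: field_simps)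
  qed
  show ?thesis
    by (rule that[of "2 ^ m / of_nat N" f]) (use N hom odd_sum in auto)
qed

section \<open>Jumps of winding numbers\<close>

text \<open>Contribution of one directed edge to a total winding number. As the path is in general
  not closed, the value need not be an integer; what matters are sums over closed chains and the
  jump across the segment.\<close>

definition seg_wn :: "complex \<times> complex \<Rightarrow> complex \<Rightarrow> complex" where
  "seg_wn e = winding_number (linepath (fst e) (snd e))"

lemma continuous_seg_wn:
  "z \<notin> closed_segment (fst e) (snd e) \<Longrightarrow> isCont (seg_wn e) z"
  unfolding seg_wn_def by (rule continuous_at_winding_number) auto

lemma seg_wn_swap:
  assumes "z \<notin> closed_segment p q"
  shows "seg_wn (q, p) z = - seg_wn (p, q) z"
  using winding_number_reversepath[of "linepath p q" z] assms by (simp add: seg_wn_def)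

lemma triangle_path_image:
  "path_image (linepath a b +++ linepath b c +++ linepath c a) =
     closed_segment a b \<union> closed_segment b c \<union> closed_segment c a"
  by (simp add: path_image_join Un_assoc)

lemma seg_wn_triangle:
  assumes "z \<notin> closed_segment a b" "z \<notin> closed_segment b c" "z \<notin> closed_segment c a"
  shows "seg_wn (a, b) z + seg_wn (b, c) z + seg_wn (c, a) z =
         winding_number (linepath a b +++ linepath b c +++ linepath c a) z"
  using assms by (simp add: seg_wn_def winding_number_join path_image_join not_in_path_image_join)

lemma seg_wn_triangle_outside:
  assumes "z \<notin> convex hull {a, b, c}"
  shows "seg_wn (a, b) z + seg_wn (b, c) z + seg_wn (c, a) z = 0"
proof -
  have sub: "closed_segment a b \<subseteq> convex hull {a, b, c}" "closed_segment b c \<subseteq> convex hull {a, b, c}"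
       "closed_segment c a \<subseteq> convex hull {a, b, c}"
    unfolding segment_convex_hull by (auto intro!: hull_mono)
  have "winding_number (linepath a b +++ linepath b c +++ linepath c a) z = 0"
    by (rule winding_number_zero_outside[of _ "convex hull {a, b, c}"])
       (use sub assms in \<open>auto simp: triangle_path_image\<close>)
  then show ?thesis using seg_wn_triangle[of z a b c] sub assms by auto
qed

text \<open>The sign condition says that \<open>z\<close> lies to the left of the directed line from
  \<open>a\<close> to \<open>b\<close>, that is, that the triangle is traversed
  counterclockwise.\<close>

lemma seg_wn_triangle_inside:
  assumes "z \<in> interior (convex hull {a, b, c})"
  shows "seg_wn (a, b) z + seg_wn (b, c) z + seg_wn (c, a) z =
           (if 0 < Im ((b - a) * cnj (b - z)) then 1 else -1)"
proof -
  have "z \<notin> closed_segment a b" "z \<notin> closed_segment b c" "z \<notin> closed_segment c a"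
    using assms by (auto simp: interior_of_triangle)
  then show ?thesis using seg_wn_triangle winding_number_triangle[OF assms] by simp
qed

text \<open>The triangle \<open>p, q, p + \<i> d\<close> closes up the segment; its other two sides do not contribute to the jump.\<close>

lemma seg_wn_jump:
  fixes p d :: complex and r t :: real
  assumes d: "d \<noteq> 0" and r: "r > 0" and t: "0 < t" "t < 1"
  defines "q \<equiv> p + of_real r * d"
  defines "z \<equiv> p + of_real t * (q - p)"
  shows "((\<lambda>\<epsilon>. seg_wn (p, q) (z + of_real \<epsilon> * \<i> * d) - seg_wn (p, q) (z - of_real \<epsilon> * \<i> * d))
           \<longlongrightarrow> 1) (at_right 0)"
proof -
  define c where "c = p + \<i> * d"
  have comb: "z + of_real \<epsilon> * \<i> * d = of_real (1 - t - \<epsilon>) * p + of_real t * q + of_real \<epsilon> * c" for \<epsilon> :: real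
    by (simp add: z_def c_def algebra_simps)
  have lim: "((\<lambda>\<epsilon>. seg_wn e (z + of_real \<epsilon> * \<i> * d) - seg_wn e (z - of_real \<epsilon> * \<i> * d)) \<longlongrightarrow> 0) (at_right 0)"
    if "z \<notin> closed_segment (fst e) (snd e)" for e
  proof -
    have c: "isCont (seg_wn e) z" using continuous_seg_wn[OF that] .
    have "((\<lambda>\<epsilon>::real. z + of_real \<epsilon> * \<i> * d) \<longlongrightarrow> z) (at_right 0)" "((\<lambda>\<epsilon>::real. z - of_real \<epsilon> * \<i> * d) \<longlongrightarrow> z) (at_right 0)"
      by (auto intro!: tendsto_eq_intros)
    then have "((\<lambda>\<epsilon>. seg_wn e (z + of_real \<epsilon> * \<i> * d) - seg_wn e (z - of_real \<epsilon> * \<i> * d)) \<longlongrightarrow> seg_wn e z - seg_wn e z) (at_right 0)"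
      by (intro tendsto_diff isCont_tendsto_compose[OF c])
    then show ?thesis by simp
  qed
  have cancel: "x = y" if "p + x * d = p + y * d" for x y
    using that d by simp
  \<comment> \<open>With \<open>p\<close> as origin and \<open>d\<close> as unit, the triangle has
    the vertices \<open>0\<close>, \<open>r\<close> and \<open>\<i>\<close>, and the two points near
    \<open>z\<close> become \<open>t * r\<close> plus or minus
    \<open>\<epsilon> * \<i>\<close>.\<close>
  have coords: "q = p + of_real r * d" "c = p + \<i> * d" "z = p + of_real (t * r) * d"
      "z + of_real \<epsilon> * \<i> * d = p + Complex (t * r) \<epsilon> * d"
      "z - of_real \<epsilon> * \<i> * d = p + Complex (t * r) (- \<epsilon>) * d" for \<epsilon>
    by (simp_all add: z_def c_def q_def Complex_eq algebra_simps)
  have seg_pq: "Im x = 0" if x: "p + x * d \<in> closed_segment p q" for x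
  proof -
    obtain u where "p + x * d = (1 - u) *\<^sub>R p + u *\<^sub>R q"
      using x unfolding closed_segment_def by blast
    then have "p + x * d = p + of_real (u * r) * d"
      by (simp add: coords scaleR_conv_of_real algebra_simps)
    from cancel[OF this] show ?thesis by simp
  qed
  have seg_qc: "Re x + r * Im x = r" if x: "p + x * d \<in> closed_segment q c" for x
  proof -
    obtain u where "p + x * d = (1 - u) *\<^sub>R q + u *\<^sub>R c"
      using x unfolding closed_segment_def by blast
    then have "p + x * d = p + Complex ((1 - u) * r) u * d"
      by (simp add: coords Complex_eq scaleR_conv_of_real algebra_simps)
    from cancel[OF this] show ?thesis by (simp add: algebra_simps)
  qed
  have seg_cp: "Re x = 0" if x: "p + x * d \<in> closed_segment c p" for x
  proof -
    obtain u where "p + x * d = (1 - u) *\<^sub>R c + u *\<^sub>R p"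
      using x unfolding closed_segment_def by blast
    then have "p + x * d = p + (of_real (1 - u) * \<i>) * d"
      by (simp add: coords scaleR_conv_of_real algebra_simps)
    from cancel[OF this] show ?thesis by simp
  qed
  have zq: "z \<notin> closed_segment q c" "z \<notin> closed_segment c p"
    using seg_qc[of "of_real (t * r)"] seg_cp[of "of_real (t * r)"] r t by (auto simp: coords(3))
  have "((\<lambda>\<epsilon>. 1 - (seg_wn (q, c) (z + of_real \<epsilon> * \<i> * d) - seg_wn (q, c) (z - of_real \<epsilon> * \<i> * d))
             - (seg_wn (c, p) (z + of_real \<epsilon> * \<i> * d) - seg_wn (c, p) (z - of_real \<epsilon> * \<i> * d))) \<longlongrightarrow> 1 - 0 - 0) (at_right 0)"
    using zq by (intro tendsto_intros lim) auto
  \<comment> \<open>For \<open>0 < \<epsilon> < 1 - t\<close> the left point is inside the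
    counterclockwise triangle and the right one outside, so the three sides together jump by exactly
    1.\<close>
  moreover have "\<forall>\<^sub>F \<epsilon> in at_right 0.
      1 - (seg_wn (q, c) (z + of_real \<epsilon> * \<i> * d) - seg_wn (q, c) (z - of_real \<epsilon> * \<i> * d))
             - (seg_wn (c, p) (z + of_real \<epsilon> * \<i> * d) - seg_wn (c, p) (z - of_real \<epsilon> * \<i> * d)) =
      seg_wn (p, q) (z + of_real \<epsilon> * \<i> * d) - seg_wn (p, q) (z - of_real \<epsilon> * \<i> * d)"
  proof -
    have "seg_wn (p, q) (z + of_real \<epsilon> * \<i> * d) + seg_wn (q, c) (z + of_real \<epsilon> * \<i> * d) +
        seg_wn (c, p) (z + of_real \<epsilon> * \<i> * d) = 1"
      if "0 < \<epsilon>" "\<epsilon> < 1 - t" for \<epsilon>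
    proof -
      have "z + of_real \<epsilon> * \<i> * d = (1 - t - \<epsilon>) *\<^sub>R p + t *\<^sub>R q + \<epsilon> *\<^sub>R c"
        using comb by (simp add: scaleR_conv_of_real)
      then have "z + of_real \<epsilon> * \<i> * d \<in> convex hull {p, q, c}"
        unfolding convex_hull_3 mem_Collect_eq
        by (intro exI[of _ "1 - t - \<epsilon>"] exI[of _ t] exI[of _ \<epsilon>]) (use that t in auto)
      moreover have "z + of_real \<epsilon> * \<i> * d \<notin> closed_segment p q"
        using seg_pq[of "Complex (t * r) \<epsilon>"] that coords(4) by auto
      moreover have "z + of_real \<epsilon> * \<i> * d \<notin> closed_segment q c"
      proof
        assume "z + of_real \<epsilon> * \<i> * d \<in> closed_segment q c"
        then have "r * (t + \<epsilon>) = r * 1"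
          using seg_qc[of "Complex (t * r) \<epsilon>"] coords(4) by (simp add: algebra_simps)
        then show False using r that by simp
      qed
      moreover have "z + of_real \<epsilon> * \<i> * d \<notin> closed_segment c p"
        using seg_cp[of "Complex (t * r) \<epsilon>"] r t coords(4) by auto
      ultimately have "z + of_real \<epsilon> * \<i> * d \<in> interior (convex hull {p, q, c})"
        by (simp add: interior_of_triangle)
      moreover have "0 < Im ((q - p) * cnj (q - (z + of_real \<epsilon> * \<i> * d)))"
      proof -
        have "q - (z + of_real \<epsilon> * \<i> * d) = Complex (r - t * r) (- \<epsilon>) * d"
          unfolding coords(1,4) by (simp add: Complex_eq algebra_simps)
        moreover have "Im (of_real r * d * cnj (Complex (r - t * r) (- \<epsilon>) * d)) = r * \<epsilon> * ((Re d)\<^sup>2 + (Im d)\<^sup>2)"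
          by (simp add: algebra_simps power2_eq_square)
        moreover have "(Re d)\<^sup>2 + (Im d)\<^sup>2 > 0" using d by (simp add: complex_neq_0)
        ultimately show ?thesis using r that by (simp add: q_def)
      qed
      ultimately show ?thesis by (simp only: seg_wn_triangle_inside if_True)
    qed
    moreover have "seg_wn (p, q) (z - of_real \<epsilon> * \<i> * d) + seg_wn (q, c) (z - of_real \<epsilon> * \<i> * d) +
        seg_wn (c, p) (z - of_real \<epsilon> * \<i> * d) = 0"
      if "0 < \<epsilon>" for \<epsilon>
    proof (rule seg_wn_triangle_outside, rule notI)
      assume "z - of_real \<epsilon> * \<i> * d \<in> convex hull {p, q, c}"
      then obtain u v w where uvw: "0 \<le> w" "u + v + w = 1"
          "p + Complex (t * r) (- \<epsilon>) * d = u *\<^sub>R p + v *\<^sub>R q + w *\<^sub>R c"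
        unfolding convex_hull_3 coords(5) by blast
      have u: "u = 1 - v - w" using uvw by simp
      have "p + Complex (t * r) (- \<epsilon>) * d = p + Complex (v * r) w * d"
        unfolding uvw(3) u by (simp add: coords Complex_eq scaleR_conv_of_real algebra_simps)
      from cancel[OF this] show False using uvw that by simp
    qed
    moreover have "\<forall>\<^sub>F \<epsilon> in at_right 0. 0 < \<epsilon> \<and> \<epsilon> < 1 - t"
      using t by (auto simp: eventually_at_right_field intro: exI[of _ "1 - t"])
    ultimately show ?thesis
      by (auto elim!: eventually_mono simp: algebra_simps)
  qed
  ultimately show ?thesis by (simp add: filterlim_cong)
qed


section \<open>Cancellation of directed edges along a line\<close>

lemma finite_line_Int_segment:
  fixes p d a b :: complex
  assumes d: "d \<noteq> 0" and off: "\<not> (\<exists>\<alpha> \<beta>. a = p + of_real \<alpha> * d \<and> b = p + of_real \<beta> * d)"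
  shows "finite {t::real. p + of_real t * d \<in> closed_segment a b}"
proof -
  define a' b' where "a' = (a - p) / d" and "b' = (b - p) / d"
  have ab: "a = p + a' * d" "b = p + b' * d" using d by (simp_all add: a'_def b'_def)
  have ne: "\<not> (Im a' = 0 \<and> Im b' = 0)"
    using off ab by (metis complex_is_Real_iff Reals_cases)
  \<comment> \<open>The line is now the real axis. The imaginary part is affine along the segment
    and not identically zero, so \<open>u\<close> is the only parameter at which it can
    vanish.\<close>
  define u where "u = Im a' / (Im a' - Im b')"
  have "{t::real. p + of_real t * d \<in> closed_segment a b} \<subseteq> {(1 - u) * Re a' + u * Re b'}"
  proof safe
    fix t :: real
    assume "p + of_real t * d \<in> closed_segment a b"
    then obtain v where "p + of_real t * d = (1 - v) *\<^sub>R a + v *\<^sub>R b"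
      unfolding closed_segment_def by blast
    then have "of_real t * d = (of_real (1 - v) * a' + of_real v * b') * d"
      unfolding ab by (simp add: scaleR_conv_of_real algebra_simps)
    then have t: "of_real t = of_real (1 - v) * a' + of_real v * b'" using d by simp
    from arg_cong[OF t, of Im] have im: "(1 - v) * Im a' + v * Im b' = 0" by simp
    then have "v * (Im a' - Im b') = Im a'" by (simp add: algebra_simps)
    moreover from this have "Im a' - Im b' \<noteq> 0" using ne by auto
    ultimately have "v = u" by (simp add: u_def field_simps)
    then show "t = (1 - u) * Re a' + u * Re b'" using arg_cong[OF t, of Re] by simp
  qed
  then show ?thesis by (rule finite_subset) simp
qed

text \<open>Integrate over \<open>t\<close>: the signed indicator of a directed interval has
  integral \<open>\<beta> i - \<alpha> i\<close>, and the finite set \<open>B\<close> is a null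
  set.\<close>

lemma sum_lengths_eq_0:
  fixes \<alpha> \<beta> :: "'i \<Rightarrow> real"
  assumes J: "finite J" and B: "finite B"
    and eq: "\<And>t. t \<notin> B \<Longrightarrow> (\<Sum>i\<in>J. indicator {\<alpha> i<..<\<beta> i} t - indicator {\<beta> i<..<\<alpha> i} t) = (0::real)"
  shows "(\<Sum>i\<in>J. \<beta> i - \<alpha> i) = 0"
proof -
  have int: "integrable lborel (indicator {a<..<b} :: real \<Rightarrow> real)" for a b :: real
    by (cases "a \<le> b") (auto simp: integrable_indicator_iff)
  have "(\<integral>t. (\<Sum>i\<in>J. indicator {\<alpha> i<..<\<beta> i} t - indicator {\<beta> i<..<\<alpha> i} t) \<partial>lborel) =
        (\<Sum>i\<in>J. measure lborel {\<alpha> i<..<\<beta> i} - measure lborel {\<beta> i<..<\<alpha> i})"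
    by (simp add: int Bochner_Integration.integral_sum Bochner_Integration.integral_diff)
  also have "\<dots> = (\<Sum>i\<in>J. \<beta> i - \<alpha> i)"
  proof (rule sum.cong)
    fix i
    show "measure lborel {\<alpha> i<..<\<beta> i} - measure lborel {\<beta> i<..<\<alpha> i} = \<beta> i - \<alpha> i"
      by (cases "\<alpha> i \<le> \<beta> i") auto
  qed simp
  finally have "(\<Sum>i\<in>J. \<beta> i - \<alpha> i) =
      (\<integral>t. (\<Sum>i\<in>J. indicator {\<alpha> i<..<\<beta> i} t - indicator {\<beta> i<..<\<alpha> i} t) \<partial>lborel)" by simp
  also have "\<dots> = 0"
  proof (rule integral_eq_zero_AE)
    have "AE t in lborel. t \<notin> B"
      using B by (intro AE_not_in) (auto simp: null_sets_def finite_imp_closed emeasure_lborel_countable countable_finite)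
    then show "AE t in lborel. (\<Sum>i\<in>J. indicator {\<alpha> i<..<\<beta> i} t - indicator {\<beta> i<..<\<alpha> i} t) = (0::real)"
      by eventually_elim (rule eq)
  qed
  finally show ?thesis .
qed

text \<open>Compare the total winding number on both sides of a point \<open>p + t * d\<close>.
  Edges off the line contribute continuously for almost all \<open>t\<close>, while an edge through
  the point along the line jumps by 1 or -1 according to its direction. As the total is zero on both
  sides, the signed count of edges covering the point vanishes.\<close>

lemma sum_line_lengths_eq_0:
  fixes e :: "'i \<Rightarrow> complex \<times> complex" and \<alpha> \<beta> :: "'i \<Rightarrow> real"
  assumes I: "finite I" and d: "d \<noteq> 0"
    and wn: "\<And>z. (\<forall>i\<in>I. z \<notin> closed_segment (fst (e i)) (snd (e i))) \<Longrightarrow> (\<Sum>i\<in>I. seg_wn (e i) z) = 0"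
    and J: "J \<subseteq> I" "\<And>i. i \<in> J \<Longrightarrow> e i = (p + of_real (\<alpha> i) * d, p + of_real (\<beta> i) * d)"
    and off: "\<And>i \<alpha> \<beta>. i \<in> I - J \<Longrightarrow> e i \<noteq> (p + of_real \<alpha> * d, p + of_real \<beta> * d)"
  shows "(\<Sum>i\<in>J. \<beta> i - \<alpha> i) = 0"
proof (rule sum_lengths_eq_0)
  \<comment> \<open>Exceptional parameters: endpoints of edges on the line, and points where other
    edges meet it.\<close>
  define B where "B = (\<alpha> ` J \<union> \<beta> ` J) \<union>
    (\<Union>i\<in>I - J. {t. p + of_real t * d \<in> closed_segment (fst (e i)) (snd (e i))})"
  show fJ: "finite J" using I J(1) finite_subset by blast
  have "finite {t. p + of_real t * d \<in> closed_segment (fst (e i)) (snd (e i))}" if "i \<in> I - J" for i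
    using off[OF that] by (intro finite_line_Int_segment d) (metis prod.collapse)
  then show "finite B" unfolding B_def using I fJ by auto
  fix t assume t: "t \<notin> B"
  define z where "z = p + of_real t * d"
  define g where "g i \<epsilon> = seg_wn (e i) (z + of_real \<epsilon> * \<i> * d) - seg_wn (e i) (z - of_real \<epsilon> * \<i> * d)"
    for i and \<epsilon> :: real
  define w where "w i = (if i \<in> J then indicator {\<alpha> i<..<\<beta> i} t - indicator {\<beta> i<..<\<alpha> i} t else (0::real))" for i
  have lims: "((\<lambda>\<epsilon>::real. z + of_real \<epsilon> * \<i> * d) \<longlongrightarrow> z) (at_right 0)"
       "((\<lambda>\<epsilon>::real. z - of_real \<epsilon> * \<i> * d) \<longlongrightarrow> z) (at_right 0)"
    by (auto intro!: tendsto_eq_intros)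
  have lim0: "(g i \<longlongrightarrow> 0) (at_right 0)" if "z \<notin> closed_segment (fst (e i)) (snd (e i))" for i
  proof -
    have "(g i \<longlongrightarrow> seg_wn (e i) z - seg_wn (e i) z) (at_right 0)"
      unfolding g_def
      by (intro tendsto_diff isCont_tendsto_compose[OF continuous_seg_wn[OF that]] lims)
    then show ?thesis by simp
  qed
  have zI: "z \<notin> closed_segment (fst (e i)) (snd (e i))" if "i \<in> I - J" for i
    using t that by (auto simp: B_def z_def)
  have segJ: "x \<in> \<real>" if x: "i \<in> J" "p + x * d \<in> closed_segment (fst (e i)) (snd (e i))" for i x
  proof -
    obtain u where "p + x * d = (1 - u) *\<^sub>R (p + of_real (\<alpha> i) * d) + u *\<^sub>R (p + of_real (\<beta> i) * d)"
      using x J(2)[of i] unfolding closed_segment_def by auto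
    then have "x * d = of_real ((1 - u) * \<alpha> i + u * \<beta> i) * d"
      by (simp add: scaleR_conv_of_real algebra_simps)
    then show ?thesis using d by simp
  qed
  have zJ: "t \<in> closed_segment (\<alpha> i) (\<beta> i)" if x: "i \<in> J" "z \<in> closed_segment (fst (e i)) (snd (e i))" for i
  proof -
    obtain u where u: "0 \<le> u" "u \<le> 1" "z = (1 - u) *\<^sub>R (p + of_real (\<alpha> i) * d) + u *\<^sub>R (p + of_real (\<beta> i) * d)"
      using x J(2)[of i] unfolding closed_segment_def by auto
    then have "of_real t * d = of_real ((1 - u) * \<alpha> i + u * \<beta> i) * d"
      by (simp add: z_def scaleR_conv_of_real algebra_simps)
    then have "t = (1 - u) * \<alpha> i + u * \<beta> i" using d by (metis mult_cancel_right of_real_eq_iff)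
    then show ?thesis using u unfolding closed_segment_def by auto
  qed
  have jump: "((\<lambda>\<epsilon>. seg_wn (p + of_real a * d, p + of_real b * d) (z + of_real \<epsilon> * \<i> * d) -
        seg_wn (p + of_real a * d, p + of_real b * d) (z - of_real \<epsilon> * \<i> * d)) \<longlongrightarrow> 1) (at_right 0)"
    if ab: "a < t" "t < b" for a b
  proof -
    have q: "p + of_real a * d + of_real (b - a) * d = p + of_real b * d" by (simp add: algebra_simps)
    have z: "p + of_real a * d + of_real ((t - a) / (b - a)) * (p + of_real b * d - (p + of_real a * d)) = z"
    proof -
      have "of_real ((t - a) / (b - a)) * (p + of_real b * d - (p + of_real a * d)) =
            of_real ((t - a) / (b - a) * (b - a)) * d"
        by (simp only: of_real_mult of_real_diff add_diff_cancel_left mult.assoc left_diff_distrib)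
      also have "\<dots> = of_real (t - a) * d" using ab by simp
      finally show ?thesis by (simp add: z_def algebra_simps)
    qed
    show ?thesis
      using seg_wn_jump[of d "b - a" "(t - a) / (b - a)" "p + of_real a * d"] d ab
      unfolding q z by simp
  qed
  have lim: "(g i \<longlongrightarrow> of_real (w i)) (at_right 0)" if "i \<in> I" for i
  proof (cases "i \<in> J")
    case False
    then show ?thesis using lim0[OF zI] that by (simp add: w_def)
  next
    case True
    have ne: "t \<noteq> \<alpha> i" "t \<noteq> \<beta> i" using t True by (auto simp: B_def)
    consider "\<alpha> i < t" "t < \<beta> i" | "\<beta> i < t" "t < \<alpha> i" | "t \<notin> closed_segment (\<alpha> i) (\<beta> i)"
      using ne by (fastforce simp: closed_segment_eq_real_ivl split: if_splits)
    then show ?thesis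
    proof cases
      case 1
      then show ?thesis
        unfolding g_def w_def J(2)[OF True] using jump[OF 1] True by simp
    next
      case 2
      \<comment> \<open>An edge directed against \<open>d\<close> is reversed first, which changes
        the sign of its jump.\<close>
      have "((\<lambda>\<epsilon>. - (seg_wn (prod.swap (e i)) (z + of_real \<epsilon> * \<i> * d) - seg_wn (prod.swap (e i)) (z - of_real \<epsilon> * \<i> * d))) \<longlongrightarrow> - 1) (at_right 0)"
        using jump[OF 2] J(2)[OF True] by (intro tendsto_minus) simp
      moreover have "\<forall>\<^sub>F \<epsilon> in at_right 0. - (seg_wn (prod.swap (e i)) (z + of_real \<epsilon> * \<i> * d) - seg_wn (prod.swap (e i)) (z - of_real \<epsilon> * \<i> * d)) = g i \<epsilon>"
        unfolding eventually_at_right_field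
      proof (intro exI conjI allI impI)
        fix \<epsilon> :: real assume \<epsilon>: "0 < \<epsilon>"
        have "z + of_real \<epsilon> * \<i> * d = p + Complex t \<epsilon> * d" "z - of_real \<epsilon> * \<i> * d = p + Complex t (- \<epsilon>) * d"
          by (simp_all add: z_def Complex_eq algebra_simps)
        then have "z + of_real \<epsilon> * \<i> * d \<notin> closed_segment (fst (e i)) (snd (e i))"
            "z - of_real \<epsilon> * \<i> * d \<notin> closed_segment (fst (e i)) (snd (e i))"
          using segJ[OF True, of "Complex t \<epsilon>"] segJ[OF True, of "Complex t (- \<epsilon>)"] \<epsilon>
          by (auto simp: complex_is_Real_iff)
        then show "- (seg_wn (prod.swap (e i)) (z + of_real \<epsilon> * \<i> * d) - seg_wn (prod.swap (e i)) (z - of_real \<epsilon> * \<i> * d)) = g i \<epsilon>"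
          by (cases "e i") (simp add: g_def seg_wn_swap)
      qed (rule zero_less_one)
      ultimately have "(g i \<longlongrightarrow> - 1) (at_right 0)" by (rule Lim_transform_eventually)
      then show ?thesis using 2 True by (simp add: w_def)
    next
      case 3
      then have "t \<notin> {\<alpha> i<..<\<beta> i}" "t \<notin> {\<beta> i<..<\<alpha> i}"
        by (auto simp: closed_segment_eq_real_ivl split: if_splits)
      then show ?thesis using lim0[of i] zJ[OF True] 3 by (auto simp: w_def)
    qed
  qed
  have "((\<lambda>\<epsilon>. \<Sum>i\<in>I. g i \<epsilon>) \<longlongrightarrow> (\<Sum>i\<in>I. of_real (w i))) (at_right 0)"
    by (intro tendsto_sum lim)
  \<comment> \<open>For small \<open>\<epsilon>\<close> both shifted points avoid every edge, so
    \<open>wn\<close> applies to each of them.\<close>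
  moreover have "\<forall>\<^sub>F \<epsilon> in at_right 0. (\<Sum>i\<in>I. g i \<epsilon>) = 0"
  proof -
    have "\<forall>\<^sub>F \<epsilon> in at_right 0. z + of_real \<epsilon> * \<i> * d \<notin> closed_segment (fst (e i)) (snd (e i)) \<and>
             z - of_real \<epsilon> * \<i> * d \<notin> closed_segment (fst (e i)) (snd (e i))" if "i \<in> I" for i
    proof (cases "i \<in> J")
      case True
      show ?thesis unfolding eventually_at_right_field
      proof (intro exI conjI allI impI)
        fix \<epsilon> :: real assume \<epsilon>: "0 < \<epsilon>"
        have "z + of_real \<epsilon> * \<i> * d = p + Complex t \<epsilon> * d" "z - of_real \<epsilon> * \<i> * d = p + Complex t (- \<epsilon>) * d"
          by (simp_all add: z_def Complex_eq algebra_simps)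
        then show "z + of_real \<epsilon> * \<i> * d \<notin> closed_segment (fst (e i)) (snd (e i))"
            "z - of_real \<epsilon> * \<i> * d \<notin> closed_segment (fst (e i)) (snd (e i))"
          using segJ[OF True, of "Complex t \<epsilon>"] segJ[OF True, of "Complex t (- \<epsilon>)"] \<epsilon>
          by (auto simp: complex_is_Real_iff)
      qed (rule zero_less_one)
    next
      case False
      have "open (- closed_segment (fst (e i)) (snd (e i)))" "z \<in> - closed_segment (fst (e i)) (snd (e i))"
        using zI False that by auto
      from topological_tendstoD[OF lims(1) this] topological_tendstoD[OF lims(2) this]
      show ?thesis by eventually_elim auto
    qed
    then have "\<forall>\<^sub>F \<epsilon> in at_right 0. \<forall>i\<in>I. z + of_real \<epsilon> * \<i> * d \<notin> closed_segment (fst (e i)) (snd (e i)) \<and>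
             z - of_real \<epsilon> * \<i> * d \<notin> closed_segment (fst (e i)) (snd (e i))"
      using I by (simp add: eventually_ball_finite_distrib)
    then show ?thesis
      by eventually_elim (simp add: g_def sum_subtractf wn)
  qed
  ultimately have "((\<lambda>\<epsilon>. 0) \<longlongrightarrow> (\<Sum>i\<in>I. of_real (w i) :: complex)) (at_right (0::real))"
    by (rule Lim_transform_eventually)
  then have "(\<Sum>i\<in>I. of_real (w i)) = (0::complex)"
    using tendsto_unique[OF trivial_limit_at_right_real] tendsto_const by blast
  then have "(\<Sum>i\<in>I. w i) = 0" by (metis of_real_sum of_real_eq_0_iff)
  moreover have "(\<Sum>i\<in>I. w i) = (\<Sum>i\<in>J. w i)"
    by (rule sum.mono_neutral_right) (use I J in \<open>auto simp: w_def\<close>)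
  moreover have "\<dots> = (\<Sum>i\<in>J. indicator {\<alpha> i<..<\<beta> i} t - indicator {\<beta> i<..<\<alpha> i} t)"
    by (rule sum.cong) (auto simp: w_def)
  ultimately show "(\<Sum>i\<in>J. indicator {\<alpha> i<..<\<beta> i} t - indicator {\<beta> i<..<\<alpha> i} t) = (0::real)" by simp
qed

text \<open>Group the edges by their supporting line. On a line with direction \<open>d\<close> each
  edge contributes its signed length times \<open>f d\<close>, and the signed lengths add up to
  zero.\<close>

lemma sum_homogeneous_eq_0:
  fixes e :: "'i \<Rightarrow> complex \<times> complex" and f :: "complex \<Rightarrow> real"
  assumes I: "finite I"
    and wn: "\<And>z. (\<forall>i\<in>I. z \<notin> closed_segment (fst (e i)) (snd (e i))) \<Longrightarrow> (\<Sum>i\<in>I. seg_wn (e i) z) = 0"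
    and hom: "\<And>s z. f (of_real s * z) = s * f z"
  shows "(\<Sum>i\<in>I. f (snd (e i) - fst (e i))) = 0"
proof -
  define line where "line i = range (\<lambda>t. fst (e i) + of_real t * (snd (e i) - fst (e i)))" for i
  define I' where "I' = {i \<in> I. fst (e i) \<noteq> snd (e i)}"
  have fI': "finite I'" using I by (simp add: I'_def)
  have f0: "f 0 = 0" using hom[of 0 0] by simp
  have "(\<Sum>i\<in>I. f (snd (e i) - fst (e i))) = (\<Sum>i\<in>I'. f (snd (e i) - fst (e i)))"
    by (rule sum.mono_neutral_right) (use I f0 in \<open>auto simp: I'_def\<close>)
  also have "\<dots> = (\<Sum>L\<in>line ` I'. \<Sum>i\<in>{i \<in> I'. line i = L}. f (snd (e i) - fst (e i)))"
    by (rule sum.image_gen[OF fI'])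
  also have "\<dots> = 0"
  proof (rule sum.neutral, safe)
    fix j assume j: "j \<in> I'"
    define p d where "p = fst (e j)" and "d = snd (e j) - fst (e j)"
    have d: "d \<noteq> 0" using j by (auto simp: I'_def d_def)
    \<comment> \<open>Degenerate edges on the line are included, because the edges outside
      \<open>J\<close> must not lie on it; their signed length is zero.\<close>
    define J where "J = {i \<in> I. \<exists>\<alpha> \<beta>. e i = (p + of_real \<alpha> * d, p + of_real \<beta> * d)}"
    have "\<forall>i\<in>J. \<exists>\<alpha> \<beta>. e i = (p + of_real \<alpha> * d, p + of_real \<beta> * d)" by (simp add: J_def)
    then obtain \<alpha> \<beta> where ab: "\<And>i. i \<in> J \<Longrightarrow> e i = (p + of_real (\<alpha> i) * d, p + of_real (\<beta> i) * d)"
      by metis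
    have "(\<Sum>i\<in>J. \<beta> i - \<alpha> i) = 0"
      by (rule sum_line_lengths_eq_0[OF I d wn _ ab]) (auto simp: J_def)
    have fi: "f (snd (e i) - fst (e i)) = (\<beta> i - \<alpha> i) * f d" if "i \<in> J" for i
    proof -
      have "snd (e i) - fst (e i) = of_real (\<beta> i - \<alpha> i) * d"
        using ab[OF that] by (simp add: algebra_simps)
      then show ?thesis by (simp only: hom)
    qed
    have line: "line i = line j \<longleftrightarrow> i \<in> J" if i: "i \<in> I'" for i
    proof
      assume *: "line i = line j"
      have "fst (e i) \<in> line i" unfolding line_def by (rule range_eqI[of _ _ 0]) simp
      moreover have "snd (e i) \<in> line i" unfolding line_def by (rule range_eqI[of _ _ 1]) simp
      moreover have "line j = range (\<lambda>t. p + of_real t * d)" by (simp add: line_def d_def p_def)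
      ultimately obtain a b where "fst (e i) = p + of_real a * d" "snd (e i) = p + of_real b * d"
        unfolding * by auto
      then show "i \<in> J" using i unfolding J_def I'_def by (metis (mono_tags, lifting) mem_Collect_eq prod.collapse)
    next
      assume iJ: "i \<in> J"
      have ne: "\<beta> i - \<alpha> i \<noteq> 0" using ab[OF iJ] i by (auto simp: I'_def)
      have eq: "fst (e i) + of_real t * (snd (e i) - fst (e i)) = p + of_real (\<alpha> i + t * (\<beta> i - \<alpha> i)) * d" for t
        using ab[OF iJ] by (simp add: algebra_simps)
      have "line i = (\<lambda>s. p + of_real s * d) ` range (\<lambda>t. \<alpha> i + t * (\<beta> i - \<alpha> i))"
        unfolding line_def eq by (simp add: image_image)
      moreover have "range (\<lambda>t. \<alpha> i + t * (\<beta> i - \<alpha> i)) = UNIV"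
      proof (rule surjI)
        show "\<alpha> i + ((s - \<alpha> i) / (\<beta> i - \<alpha> i)) * (\<beta> i - \<alpha> i) = s" for s using ne by simp
      qed
      ultimately show "line i = line j" by (simp add: line_def p_def d_def)
    qed
    have "(\<Sum>i\<in>{i \<in> I'. line i = line j}. f (snd (e i) - fst (e i))) = (\<Sum>i\<in>I' \<inter> J. (\<beta> i - \<alpha> i) * f d)"
      by (rule sum.cong) (use line fi in auto)
    also have "\<dots> = (\<Sum>i\<in>J. (\<beta> i - \<alpha> i) * f d)"
    proof (rule sum.mono_neutral_left)
      show "\<forall>i\<in>J - I' \<inter> J. (\<beta> i - \<alpha> i) * f d = 0"
      proof
        fix i assume i: "i \<in> J - I' \<inter> J"
        then have "fst (e i) = snd (e i)" by (auto simp: J_def I'_def)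
        then show "(\<beta> i - \<alpha> i) * f d = 0" using ab[of i] i d by simp
      qed
    qed (use I in \<open>auto simp: J_def\<close>)
    also have "\<dots> = 0" using \<open>(\<Sum>i\<in>J. \<beta> i - \<alpha> i) = 0\<close> by (simp flip: sum_distrib_right)
    finally show "(\<Sum>i\<in>{i \<in> I'. line i = line j}. f (snd (e i) - fst (e i))) = 0" .
  qed
  finally show ?thesis .
qed

section \<open>Triangles and polygons\<close>

text \<open>The coordinate map \<open>\<phi>\<close> to \<open>real ^ 2\<close> is linear and
  carries \<open>lborel\<close> to \<open>lborel\<close>, as seen on boxes; this transports
  \<open>content_triangle\<close> to the complex plane.\<close>

lemma measure_lebesgue_complex_triangle:
  fixes a b c :: complex
  shows "measure lebesgue (convex hull {a, b, c}) = \<bar>cross (b - a) (c - a)\<bar> / 2"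
proof -
  define \<phi> :: "complex \<Rightarrow> real ^ 2" where "\<phi> z = vector [Re z, Im z]" for z
  have \<phi>: "linear \<phi>"
    by (rule linearI) (auto simp: \<phi>_def vec_eq_iff forall_2)
  have meas: "\<phi> \<in> borel_measurable lborel"
    using linear_continuous_on[OF \<phi>[unfolded linear_conv_bounded_linear], of UNIV]
    by (simp add: borel_measurable_continuous_onI)
  have lb: "lborel = distr lborel borel \<phi>"
  proof (rule lborel_eqI)
    fix l u :: "real ^ 2"
    assume le: "\<And>b. b \<in> Basis \<Longrightarrow> l \<bullet> b \<le> u \<bullet> b"
    have le': "l $ i \<le> u $ i" for i
      using le[of "axis i 1"] by (simp add: inner_axis axis_in_Basis_iff)
    have "\<phi> -` box l u = box (Complex (l $ 1) (l $ 2)) (Complex (u $ 1) (u $ 2))"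
      by (auto simp: mem_box_cart forall_2 \<phi>_def in_box_complex_iff)
    then have "emeasure (distr lborel borel \<phi>) (box l u) =
        emeasure lborel (box (Complex (l $ 1) (l $ 2)) (Complex (u $ 1) (u $ 2)))"
      using meas by (simp add: emeasure_distr)
    also have "\<dots> = ennreal ((u $ 1 - l $ 1) * (u $ 2 - l $ 2))"
      using le' by (subst emeasure_lborel_box) (auto simp: Basis_complex_def)
    also have "(u $ 1 - l $ 1) * (u $ 2 - l $ 2) = (\<Prod>b\<in>Basis. (u - l) \<bullet> b)"
    proof -
      have B: "(Basis :: (real ^ 2) set) = range (\<lambda>i. axis i 1)" by (auto simp: Basis_vec_def)
      have "(\<Prod>b\<in>Basis. (u - l) \<bullet> b) = (\<Prod>i\<in>(UNIV :: 2 set). (u - l) $ i)"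
        unfolding B by (subst prod.reindex) (auto simp: inner_axis inj_on_def axis_eq_axis)
      then show ?thesis by (simp add: UNIV_2)
    qed
    finally show "emeasure (distr lborel borel \<phi>) (box l u) = ennreal (\<Prod>b\<in>Basis. (u - l) \<bullet> b)" .
  qed simp
  have cl: "closed (convex hull {a, b, c})" "closed (convex hull {\<phi> a, \<phi> b, \<phi> c})"
    by (simp_all add: finite_imp_compact_convex_hull compact_imp_closed)
  have inj: "inj \<phi>" by (rule injI) (auto simp: \<phi>_def vec_eq_iff forall_2 complex_eq_iff)
  have "\<phi> ` (convex hull {a, b, c}) = convex hull {\<phi> a, \<phi> b, \<phi> c}"
    using convex_hull_linear_image[OF \<phi>, of "{a, b, c}"] by simp
  then have "convex hull {a, b, c} = \<phi> -` (convex hull {\<phi> a, \<phi> b, \<phi> c})"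
    using inj by (metis inj_vimage_image_eq)
  moreover have "measure lborel (convex hull {\<phi> a, \<phi> b, \<phi> c}) = measure lborel (\<phi> -` (convex hull {\<phi> a, \<phi> b, \<phi> c}))"
    using meas cl by (subst lb) (simp add: measure_distr borel_closed)
  ultimately have "measure lborel (convex hull {a, b, c}) = measure lborel (convex hull {\<phi> a, \<phi> b, \<phi> c})"
    by simp
  then show ?thesis
    using cl unfolding content_triangle
    by (simp add: measure_completion borel_closed \<phi>_def cross_def abs_minus_commute algebra_simps)
qed

section \<open>Polygonal boundaries and paired edges\<close>

lemma polyline_path:
  "vs \<noteq> [] \<Longrightarrow> path (polyline vs) \<and> pathstart (polyline vs) = hd vs \<and> pathfinish (polyline vs) = last vs"
  by (induction vs rule: polyline.induct) auto

lemma path_image_polyline: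
  "length vs \<ge> 2 \<Longrightarrow> path_image (polyline vs) = (\<Union>e\<in>set (zip vs (tl vs)). closed_segment (fst e) (snd e))"
  by (induction vs rule: polyline.induct) (auto simp: path_image_join polyline_path)

lemma winding_number_polyline:
  "\<lbrakk>length vs \<ge> 2; z \<notin> path_image (polyline vs)\<rbrakk> \<Longrightarrow>
     winding_number (polyline vs) z = (\<Sum>e\<leftarrow>zip vs (tl vs). seg_wn e z)"
proof (induction vs rule: polyline.induct)
  case (4 a b c vs)
  have "pathfinish (linepath a b) = pathstart (polyline (b # c # vs))" by (simp add: polyline_path)
  then have "z \<notin> closed_segment a b" "z \<notin> path_image (polyline (b # c # vs))"
    using 4 by (auto simp: path_image_join)
  then show ?case using 4 by (simp add: winding_number_join polyline_path seg_wn_def)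
qed (auto simp: seg_wn_def)

definition boundary_edges :: "complex list \<Rightarrow> (complex \<times> complex) list" where
  "boundary_edges vs = zip (vs @ [hd vs]) (tl (vs @ [hd vs]))"

lemma sum_list_boundary_edges:
  assumes "vs \<noteq> []"
  shows "(\<Sum>e\<leftarrow>boundary_edges vs. f (snd e - fst e)) = (\<Sum>i<length vs. f (edge vs i))"
proof -
  have len: "length (boundary_edges vs) = length vs" by (simp add: boundary_edges_def)
  have "boundary_edges vs ! i = (vs ! i, vs ! (Suc i mod length vs))" if "i < length vs" for i
    using that assms by (cases "Suc i = length vs") (auto simp: boundary_edges_def nth_append nth_tl hd_conv_nth)
  then show ?thesis
    by (simp add: sum_list_sum_nth len edge_def atLeast0LessThan)
qed

text \<open>Homogeneity makes \<open>f\<close> odd, so the two edges of each pair cancel.\<close>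

lemma balanced_sum_eq_0:
  fixes f :: "complex \<Rightarrow> real"
  assumes "balanced_polygon vs" and hom: "\<And>s z. f (of_real s * z) = s * f z"
  shows "(\<Sum>i<length vs. f (edge vs i)) = 0"
proof -
  obtain P where P: "partition_on {..<length vs} P"
      "\<And>A. A \<in> P \<Longrightarrow> \<exists>i j. i \<noteq> j \<and> A = {i, j} \<and> opposite_edges (edge vs i) (edge vs j)"
    using assms(1) unfolding balanced_polygon_def by auto
  have "(\<Sum>i<length vs. f (edge vs i)) = (\<Sum>A\<in>P. \<Sum>i\<in>A. f (edge vs i))"
    using P(1) P(2) unfolding partition_on_def
    by (metis (no_types, lifting) disjoint_def finite.emptyI finite_insert sum.Union_disjoint comp_apply)
  also have "\<dots> = 0"
  proof (rule sum.neutral, safe)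
    fix A assume "A \<in> P"
    then obtain i j c where ij: "i \<noteq> j" "A = {i, j}" "c < 0" "edge vs j = c *\<^sub>R edge vs i"
        "norm (edge vs i) = norm (edge vs j)"
      using P(2)[of A] unfolding opposite_edges_def by blast
    have "f (edge vs j) = - f (edge vs i)"
    proof (cases "edge vs i = 0")
      case True
      then show ?thesis using ij hom[of 0 0] by simp
    next
      case False
      \<comment> \<open>Equal lengths give \<bar>c\<bar> = 1, and \<open>c\<close> is
        negative.\<close>
      have "cmod (edge vs i) * (c + 1) = 0" using ij by (simp add: algebra_simps)
      then have "c = -1" using False by simp
      then show ?thesis using ij hom[of "-1" "edge vs i"] by simp
    qed
    then show "(\<Sum>i\<in>A. f (edge vs i)) = 0" using ij by simp
  qed
  finally show ?thesis .
qed


section \<open>Clockwise triangles and the boundary of their union\<close>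

lemma simplex_2_clockwise:
  fixes T :: "complex set"
  assumes "2 simplex T"
  obtains a b c where "T = convex hull {a, b, c}" "vertices T = {a, b, c}" "cross (b - a) (c - a) < 0"
proof -
  obtain X where X: "\<not> affine_dependent X" "int (card X) = 2 + 1" "T = convex hull X"
    using assms unfolding simplex by blast
  then obtain a b c where abc: "X = {a, b, c}" "a \<noteq> b" "a \<noteq> c" "b \<noteq> c"
    by (auto simp: card_3_iff)
  have V: "vertices T = {a, b, c}"
    using X abc by (auto simp: vertices_def extreme_point_of_convex_hull_affine_independent)
  have "cross (b - a) (c - a) \<noteq> 0"
  proof
    assume 0: "cross (b - a) (c - a) = 0"
    \<comment> \<open>A vanishing determinant means that the quotient of the two sides is real,
      hence that the vertices are collinear.\<close>
    have "Im ((c - a) / (b - a)) = 0"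
      using 0 by (simp add: Im_divide cross_def algebra_simps)
    then have "collinear {0, b - a, c - a}"
      by (simp add: collinear_iff_Reals complex_is_Real_iff)
    then have "collinear {b, a, c}" by (subst collinear_3) auto
    then have "collinear {a, b, c}" by (simp add: insert_commute)
    then show False using X abc by (simp add: collinear_3_eq_affine_dependent)
  qed
  \<comment> \<open>Exchanging \<open>b\<close> and \<open>c\<close> reverses the orientation, so
    one of the two orders is clockwise.\<close>
  moreover have "cross (c - a) (b - a) = - cross (b - a) (c - a)" by (simp add: cross_def)
  moreover have "{a, c, b} = {a, b, c}" by auto
  ultimately show ?thesis
    using that[of a b c] that[of a c b] X(3) abc(1) V by fastforce
qed

text \<open>Off the edges, \<open>z\<close> is either interior or outside. For an interior point
  with barycentric coordinate \<open>w\<close> at \<open>c\<close>, the sign condition of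
  \<open>seg_wn_triangle_inside\<close> concerns \<open>w * cross (b - a) (c - a)\<close>, which is
  not positive.\<close>

lemma seg_wn_clockwise_triangle:
  assumes neg: "cross (b - a) (c - a) < 0"
    and off: "z \<notin> closed_segment a b" "z \<notin> closed_segment b c" "z \<notin> closed_segment c a"
  shows "seg_wn (a, b) z + seg_wn (b, c) z + seg_wn (c, a) z = (if z \<in> convex hull {a, b, c} then -1 else 0)"
proof (cases "z \<in> convex hull {a, b, c}")
  case True
  then obtain u v w where uvw: "0 \<le> w" "u + v + w = 1" "z = u *\<^sub>R a + v *\<^sub>R b + w *\<^sub>R c"
    unfolding convex_hull_3 by blast
  have u: "u = 1 - v - w" using uvw by simp
  have "Im ((b - a) * cnj (b - z)) = w * cross (b - a) (c - a)"
    unfolding uvw(3) u by (simp add: cross_def algebra_simps)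
  then have "\<not> 0 < Im ((b - a) * cnj (b - z))"
    using uvw(1) neg by (simp only: not_less mult_nonneg_nonpos less_imp_le)
  moreover have "z \<in> interior (convex hull {a, b, c})"
    using True off by (simp add: interior_of_triangle)
  ultimately show ?thesis using True by (simp only: seg_wn_triangle_inside if_True if_False)
next
  case False
  then show ?thesis by (simp add: seg_wn_triangle_outside)
qed

text \<open>Indexing by list positions counts repeated edges with multiplicity.\<close>

lemma sum_list_homogeneous_eq_0:
  fixes es :: "(complex \<times> complex) list" and f :: "complex \<Rightarrow> real"
  assumes "\<And>z. (\<forall>e\<in>set es. z \<notin> closed_segment (fst e) (snd e)) \<Longrightarrow> (\<Sum>e\<leftarrow>es. seg_wn e z) = 0"
    and hom: "\<And>s z. f (of_real s * z) = s * f z"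
  shows "(\<Sum>e\<leftarrow>es. f (snd e - fst e)) = 0"
proof -
  have "(\<Sum>i<length es. f (snd (es ! i) - fst (es ! i))) = 0"
  proof (rule sum_homogeneous_eq_0[OF _ _ hom])
    fix z assume "\<forall>i\<in>{..<length es}. z \<notin> closed_segment (fst (es ! i)) (snd (es ! i))"
    then have "(\<Sum>e\<leftarrow>es. seg_wn e z) = 0" by (intro assms(1) ballI) (metis in_set_conv_nth lessThan_iff)
    then show "(\<Sum>i<length es. seg_wn (es ! i) z) = 0"
      by (simp add: sum_list_sum_nth atLeast0LessThan)
  qed simp
  then show ?thesis by (simp add: sum_list_sum_nth atLeast0LessThan)
qed

definition triangle_edges :: "complex \<times> complex \<times> complex \<Rightarrow> (complex \<times> complex) list" where
  "triangle_edges t = (case t of (a, b, c) \<Rightarrow> [(a, b), (b, c), (c, a)])"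

lemma sum_list_triangle_edges:
  fixes g :: "complex \<times> complex \<Rightarrow> 'a :: comm_monoid_add"
  shows "(\<Sum>e\<leftarrow>concat (map (\<lambda>T. triangle_edges (a T, b T, c T)) Ts). g e) =
    (\<Sum>T\<leftarrow>Ts. g (a T, b T) + (g (b T, c T) + g (c T, a T)))"
  by (induction Ts) (simp_all add: triangle_edges_def add.assoc)

text \<open>The clockwise triangle edges together with the reversed polygon edges have total winding
  number zero off all edges: a point inside the polygon lies in exactly one triangle, giving -1, and
  the reversed boundary gives 1.\<close>

lemma sum_triangles_eq_sum_boundary:
  fixes f :: "complex \<Rightarrow> real"
  assumes poly: "clockwise_polygon vs" and cut: "cut_into_triangles (polygon_region vs) \<T>"
    and A: "\<And>T. T \<in> \<T> \<Longrightarrow> convex hull {a T, b T, c T} = T \<and> cross (b T - a T) (c T - a T) < 0"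
    and hom: "\<And>s z. f (of_real s * z) = s * f z"
  shows "(\<Sum>T\<in>\<T>. f (b T - a T) + f (c T - b T) + f (a T - c T)) = (\<Sum>i<length vs. f (edge vs i))"
proof -
  have cut': "finite \<T>" "\<Union>\<T> = polygon_region vs"
      "\<And>T U. \<lbrakk>T \<in> \<T>; U \<in> \<T>; T \<noteq> U\<rbrakk> \<Longrightarrow> interior T \<inter> interior U = {}"
    using cut unfolding cut_into_triangles_def by blast+
  obtain Ts where Ts: "set Ts = \<T>" "distinct Ts"
    using finite_distinct_list[OF cut'(1)] by blast
  have vs: "length vs \<ge> 3" "vs \<noteq> []"
    and wn: "\<And>z. z \<in> inside (path_image (boundary_path vs)) \<Longrightarrow> winding_number (boundary_path vs) z = -1"
    using poly unfolding clockwise_polygon_def by auto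
  have path: "path (boundary_path vs)" "pathfinish (boundary_path vs) = pathstart (boundary_path vs)"
    using polyline_path[of "vs @ [hd vs]"] vs by (simp_all add: boundary_path_def)
  have pim: "path_image (boundary_path vs) = (\<Union>e\<in>set (boundary_edges vs). closed_segment (fst e) (snd e))"
    using vs by (simp add: boundary_path_def boundary_edges_def path_image_polyline)
  define es where "es = concat (map (\<lambda>T. triangle_edges (a T, b T, c T)) Ts) @ map prod.swap (boundary_edges vs)"
  have "(\<Sum>e\<leftarrow>es. f (snd e - fst e)) = 0"
  proof (rule sum_list_homogeneous_eq_0[OF _ hom])
    fix z assume z: "\<forall>e\<in>set es. z \<notin> closed_segment (fst e) (snd e)"
    have zT: "z \<notin> closed_segment (a T) (b T)" "z \<notin> closed_segment (b T) (c T)" "z \<notin> closed_segment (c T) (a T)"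
      if "T \<in> \<T>" for T
    proof -
      have "(a T, b T) \<in> set es" "(b T, c T) \<in> set es" "(c T, a T) \<in> set es"
        using that Ts by (auto simp: es_def triangle_edges_def)
      then show "z \<notin> closed_segment (a T) (b T)" "z \<notin> closed_segment (b T) (c T)" "z \<notin> closed_segment (c T) (a T)"
        using z by force+
    qed
    have zb: "z \<notin> closed_segment (fst e) (snd e)" if "e \<in> set (boundary_edges vs)" for e
    proof -
      have "prod.swap e \<in> set es" using that by (simp add: es_def)
      then show ?thesis using z by (metis closed_segment_commute fst_swap snd_swap)
    qed
    then have zp: "z \<notin> path_image (boundary_path vs)" by (simp add: pim)
    define I where "I = (if z \<in> inside (path_image (boundary_path vs)) then 1 else 0 :: complex)"
    have "(\<Sum>e\<leftarrow>boundary_edges vs. seg_wn (prod.swap e) z) = (\<Sum>e\<leftarrow>boundary_edges vs. - seg_wn e z)"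
      using zb by (intro arg_cong[of _ _ sum_list] map_cong) (auto simp: seg_wn_swap)
    also have "\<dots> = - (\<Sum>e\<leftarrow>boundary_edges vs. seg_wn e z)"
      by (simp add: uminus_sum_list_map comp_def)
    also have "(\<Sum>e\<leftarrow>boundary_edges vs. seg_wn e z) = winding_number (boundary_path vs) z"
      using winding_number_polyline[of "vs @ [hd vs]" z] zp vs by (simp add: boundary_path_def boundary_edges_def)
    also have "\<dots> = - I"
    proof (cases "z \<in> inside (path_image (boundary_path vs))")
      case True
      then show ?thesis by (simp add: wn I_def)
    next
      case False
      then have "z \<in> outside (path_image (boundary_path vs))"
        using zp inside_Un_outside[of "path_image (boundary_path vs)"] by blast
      then show ?thesis using False path by (simp add: winding_number_zero_in_outside I_def)
    qed
    finally have bd: "(\<Sum>e\<leftarrow>boundary_edges vs. seg_wn (prod.swap e) z) = I" by simp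
    \<comment> \<open>A point off all edges lies in the interior of every triangle containing it;
      disjoint interiors then leave only one such triangle.\<close>
    have int: "z \<in> interior T" if "T \<in> \<T>" "z \<in> T" for T
      using zT[OF that(1)] A[OF that(1)] that(2) interior_of_triangle[of "a T" "b T" "c T"] by simp
    have "(\<Sum>T\<in>\<T>. seg_wn (a T, b T) z + seg_wn (b T, c T) z + seg_wn (c T, a T) z) =
        (\<Sum>T\<in>\<T>. if z \<in> T then -1 else 0)"
    proof (rule sum.cong[OF refl])
      fix T assume T: "T \<in> \<T>"
      show "seg_wn (a T, b T) z + seg_wn (b T, c T) z + seg_wn (c T, a T) z = (if z \<in> T then -1 else 0)"
        using seg_wn_clockwise_triangle[OF conjunct2[OF A[OF T]] zT[OF T]] A[OF T] by simp
    qed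
    also have "\<dots> = - I"
    proof (cases "\<exists>T\<in>\<T>. z \<in> T")
      case True
      then obtain T where T: "T \<in> \<T>" "z \<in> T" by blast
      have "T' = T" if "T' \<in> \<T>" "z \<in> T'" for T'
        using cut'(3)[OF that(1) T(1)] int[OF that] int[OF T] by blast
      then have iff: "z \<in> T' \<longleftrightarrow> T' = T" if "T' \<in> \<T>" for T' using that T by blast
      have "(\<Sum>T\<in>\<T>. if z \<in> T then -1 else 0) = (\<Sum>T'\<in>\<T>. if T' = T then -1 else 0 :: complex)"
        by (rule sum.cong[OF refl]) (simp add: iff)
      moreover have "z \<in> inside (path_image (boundary_path vs))"
        using T cut'(2) zp unfolding polygon_region_def by blast
      ultimately show ?thesis using cut'(1) T by (simp add: I_def)
    next
      case False
      then have "z \<notin> inside (path_image (boundary_path vs))"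
        using cut'(2) unfolding polygon_region_def by blast
      then show ?thesis using False by (simp add: I_def)
    qed
    finally have "(\<Sum>T\<in>\<T>. seg_wn (a T, b T) z + (seg_wn (b T, c T) z + seg_wn (c T, a T) z)) = - I"
      by (simp only: add.assoc)
    then show "(\<Sum>e\<leftarrow>es. seg_wn e z) = 0"
      using bd Ts by (simp add: es_def sum_list_triangle_edges sum_list_distinct_conv_sum_set comp_def del: map_concat)
  qed
  moreover have "(\<Sum>e\<leftarrow>boundary_edges vs. f (snd (prod.swap e) - fst (prod.swap e))) =
      - (\<Sum>e\<leftarrow>boundary_edges vs. f (snd e - fst e))"
  proof -
    have "f (fst e - snd e) = - f (snd e - fst e)" for e using hom[of "-1" "snd e - fst e"] by simp
    then show ?thesis by (simp add: uminus_sum_list_map comp_def)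
  qed
  ultimately show ?thesis
    using sum_list_boundary_edges[OF vs(2), of f] Ts
    by (simp add: es_def sum_list_triangle_edges sum_list_distinct_conv_sum_set comp_def add.assoc del: map_concat)
qed

theorem theorem2:
  fixes vs :: "complex list"
  assumes "balanced_polygon vs"
  shows "\<not> (\<exists>\<T>. cut_into_triangles (polygon_region vs) \<T> \<and> odd (card \<T>) \<and>
           (\<forall>T\<in>\<T>. \<forall>U\<in>\<T>. measure lebesgue T = measure lebesgue U) \<and>
           (\<forall>T\<in>\<T>. \<forall>v\<in>vertices T. Re v \<in> \<rat> \<and> Im v \<in> \<rat>))"
proof
  assume "\<exists>\<T>. cut_into_triangles (polygon_region vs) \<T> \<and> odd (card \<T>) \<and>
           (\<forall>T\<in>\<T>. \<forall>U\<in>\<T>. measure lebesgue T = measure lebesgue U) \<and>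
           (\<forall>T\<in>\<T>. \<forall>v\<in>vertices T. Re v \<in> \<rat> \<and> Im v \<in> \<rat>)"
  then obtain \<T> where cut: "cut_into_triangles (polygon_region vs) \<T>" and odd: "odd (card \<T>)"
    and area: "\<And>T U. T \<in> \<T> \<Longrightarrow> U \<in> \<T> \<Longrightarrow> measure lebesgue T = measure lebesgue U"
    and rat: "\<And>T v. T \<in> \<T> \<Longrightarrow> v \<in> vertices T \<Longrightarrow> Re v \<in> \<rat> \<and> Im v \<in> \<rat>"
    by blast
  have fin: "finite \<T>" and simplex: "\<And>T. T \<in> \<T> \<Longrightarrow> 2 simplex T"
    using cut by (simp_all add: cut_into_triangles_def)
  have "\<forall>T\<in>\<T>. \<exists>a b c. convex hull {a, b, c} = T \<and> vertices T = {a, b, c} \<and> cross (b - a) (c - a) < 0"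
  proof
    fix T assume "T \<in> \<T>"
    show "\<exists>a b c. convex hull {a, b, c} = T \<and> vertices T = {a, b, c} \<and> cross (b - a) (c - a) < 0"
      by (rule simplex_2_clockwise[OF simplex[OF \<open>T \<in> \<T>\<close>]]) blast
  qed
  then obtain a b c where abc: "\<And>T. T \<in> \<T> \<Longrightarrow>
      convex hull {a T, b T, c T} = T \<and> vertices T = {a T, b T, c T} \<and> cross (b T - a T) (c T - a T) < 0"
    by metis
  obtain T0 where T0: "T0 \<in> \<T>" using odd by fastforce
  define A where "A = \<bar>cross (b T0 - a T0) (c T0 - a T0)\<bar>"
  have R: "Re v \<in> \<rat>" "Im v \<in> \<rat>" if "T \<in> \<T>" "v \<in> {a T, b T, c T}" for T v
    using rat that abc by auto
  \<comment> \<open>\<open>A\<close> is twice the common area. The determinant is taken for two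
    consecutive edges, as \<open>odd_edge_functional\<close> expects.\<close>
  have A: "\<bar>cross (b T - a T) (c T - b T)\<bar> = A" if "T \<in> \<T>" for T
  proof -
    have m: "measure lebesgue T = \<bar>cross (b T - a T) (c T - a T)\<bar> / 2" if "T \<in> \<T>" for T
      using measure_lebesgue_complex_triangle[of "a T" "b T" "c T"] abc[OF that] by simp
    have "\<bar>cross (b T - a T) (c T - a T)\<bar> = A"
      using area[OF that T0] m[OF that] m[OF T0] unfolding A_def by linarith
    moreover have "cross (b T - a T) (c T - b T) = cross (b T - a T) (c T - a T)"
      by (simp add: cross_def algebra_simps)
    ultimately show ?thesis by simp
  qed
  define V where "V = (\<Union>T\<in>\<T>. {b T - a T, c T - b T, a T - c T})"
  have finV: "finite V" using fin by (simp add: V_def)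
  have ratV: "Re v \<in> \<rat> \<and> Im v \<in> \<rat>" if "v \<in> V" for v
    using that R by (auto simp: V_def)
  have "b T - a T \<noteq> 0" "c T - b T \<noteq> 0" "a T - c T \<noteq> 0" if "T \<in> \<T>" for T
    using abc[OF that] by (auto simp: cross_def)
  then have nzV: "0 \<notin> V" by (auto simp: V_def)
  have "A \<in> \<rat>" using R[OF T0] unfolding A_def cross_def by simp
  moreover have "A > 0" using abc[OF T0] by (simp add: A_def)
  ultimately obtain f C where f: "C \<noteq> 0" "\<And>s z. f (of_real s * z) = s * f z"
    "\<And>u v w. \<lbrakk>u \<in> V; v \<in> V; w \<in> V; u + v + w = 0; \<bar>cross u v\<bar> = A\<rbrakk>
       \<Longrightarrow> \<exists>k::int. odd k \<and> f u + f v + f w = C * of_int k"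
    using odd_edge_functional[OF finV ratV nzV] by metis
  have "\<exists>k::int. odd k \<and> f (b T - a T) + f (c T - b T) + f (a T - c T) = C * of_int k" if "T \<in> \<T>" for T
    by (rule f(3)) (use that A in \<open>auto simp: V_def\<close>)
  then obtain k :: "complex set \<Rightarrow> int" where k: "\<And>T. T \<in> \<T> \<Longrightarrow> odd (k T)"
      "\<And>T. T \<in> \<T> \<Longrightarrow> f (b T - a T) + f (c T - b T) + f (a T - c T) = C * of_int (k T)"
    by metis
  have "C * of_int (\<Sum>T\<in>\<T>. k T) = (\<Sum>T\<in>\<T>. f (b T - a T) + f (c T - b T) + f (a T - c T))"
    by (simp add: k(2) sum_distrib_left)
  also have "\<dots> = (\<Sum>i<length vs. f (edge vs i))"
    by (rule sum_triangles_eq_sum_boundary[OF _ cut _ f(2)])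
       (use assms abc in \<open>auto simp: balanced_polygon_def\<close>)
  also have "\<dots> = 0" by (rule balanced_sum_eq_0[OF assms f(2)])
  finally have "of_int (\<Sum>T\<in>\<T>. k T) = (0::real)" using f(1) by (simp only: mult_eq_0_iff simp_thms)
  then have "(\<Sum>T\<in>\<T>. k T) = 0" by (simp only: of_int_eq_0_iff)
  \<comment> \<open>The integers \<open>k T\<close> are all odd with sum zero, so the number of
    triangles is even.\<close>
  moreover have "{T \<in> \<T>. odd (k T)} = \<T>" using k(1) by auto
  ultimately show False using odd even_sum_iff[OF fin, of k] by simp
qed

end
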